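(* For $r,s,k\in\mathbb N_0$, the number $a(r,s,k)$ of assignments of $s+k$ drivers to $r+s$ spaces such that $r$ spaces remain empty, $s$ spaces are occupied, and $k$ drivers leave, is recursively given by $$a(r,s,k)=\begin{cases}1 & \text{if } r=s=k=0,\\[2pt] a(r-1,s,0)+\displaystyle\sum_{i=0}^{k+1}\binom{s+k}{k+1-i}\,a(r,s-1,i) & \text{if } k=0 \text{ and } (r>0 \text{ or } s>0),\\[2pt] \displaystyle\sum_{i=0}^{k+1}\binom{s+k}{k+1-i}\,a(r,s-1,i) & \text{if } k>0.\end{cases}$$
   Context: Car parking problem: a car park has $n$ spaces in a line, numbered $1,\dots,n$, and $m$ drivers arrive one after the other. Each driver has chosen a preferred space, so an assignment is a function $f:\{1,\dots,m\}\to\{1,\dots,n\}$. Each arriving driver parks in the chosen space if it is free; otherwise the driver takes the first free space with a larger number, if there is one; if there is none, the driver leaves (goes home). For $r,s,k\in\mathbb N_0$, $a(r,s,k)$ denotes the number of assignments of $m=s+k$ drivers to $n=r+s$ spaces for which, in the end, $r$ spaces remain unoccupied, $s$ spaces are occupied, and $k$ drivers go home. (For $n=0$ there is exactly one assignment if $m=0$ and none if $m>0$.) By convention $a(r,s,k)=0$ whenever one of the integers $r,s,k$ is negative. *)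

theory Defs
  imports Complex_Main "HOL-Library.FuncSet"
begin

text \<open>
  The space taken by a driver with preferred space \<open>p\<close> in a car park with spaces \<open>{1..n}\<close> whose
  occupied spaces are \<open>S\<close>; \<open>None\<close> means that the driver goes home.
\<close>

definition parking_space :: "nat \<Rightarrow> nat set \<Rightarrow> nat \<Rightarrow> nat option" where
  "parking_space n S p =
     (if {p..n} - S = {} then None else Some (Min ({p..n} - S)))"

text \<open>
  \<open>park n f j\<close> is the state after drivers \<open>1, \<dots>, j\<close> have arrived: the set of occupied spaces
  and the number of drivers who have gone home.
\<close>

primrec park :: "nat \<Rightarrow> (nat \<Rightarrow> nat) \<Rightarrow> nat \<Rightarrow> nat set \<times> nat" where
  "park n f 0 = ({}, 0)"
| "park n f (Suc j) =
     (case park n f j of (S, h) \<Rightarrow>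
        (case parking_space n S (f (Suc j)) of
           None \<Rightarrow> (S, Suc h)
         | Some q \<Rightarrow> (insert q S, h)))"

text \<open>
  The extensional function space contains each assignment exactly once. The arguments are
  integers so that the count can be extended by zero to negative arguments.
\<close>

definition parking_count :: "int \<Rightarrow> int \<Rightarrow> int \<Rightarrow> nat" where
  "parking_count r s k =
     (if r < 0 \<or> s < 0 \<or> k < 0 then 0
      else let m = nat (s + k); n = nat (r + s) in
        card {f \<in> {1..m} \<rightarrow>\<^sub>E {1..n}.
                case park n f m of (S, h) \<Rightarrow>
                  card ({1..n} - S) = nat r \<and> card S = nat s \<and> h = nat k})"

end

theory Submission
  imports Defs
begin

text \<open>
  The recursion comes from looking at the last space. Let there be \<open>n + 1\<close> spaces, and let the same
  drivers arrive at the car park shortened to its first \<open>n\<close> spaces. Drivers who want space \<open>n + 1\<close>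
  find nothing at or beyond their preference in the short park and go home, so the drivers
  who go home from it are exactly those who reach space \<open>n + 1\<close> in the long one. The first of
  them, if there is any, takes this space, and the others go home (\<open>outcome_Suc\<close>). For \<open>k\<close> drivers
  to go home in the end there are thus two possibilities.

  \<^item> Nobody reaches the last space, so \<open>k = 0\<close> and the assignment is one to \<open>n\<close> spaces
    from which nobody goes home. This gives \<open>a(r - 1, s, 0)\<close>.

  \<^item> Exactly \<open>k + 1\<close> drivers reach it. If \<open>i\<close> of them had a smaller preference, then \<open>k + 1 - i\<close>
    of all \<open>s + k\<close> drivers wanted the last space, which can be distributed in
    \<open>(s + k) choose (k + 1 - i)\<close> ways, and the other drivers form an assignment to \<open>n\<close> spaces
    counted by \<open>a(r, s - 1, i)\<close>, as those who want space \<open>n + 1\<close> do not influence the first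
    \<open>n\<close> spaces (\<open>outcome_ignore_last\<close>).

  In assignments that are functions, the drivers who remain after some have been removed would have
  to be renumbered. In lists of preferences in the order of arrival, removing drivers is just
  filtering. As every driver parks or goes home
  (\<open>card_parked_plus_home\<close>), the number of spaces, of drivers and of drivers going home determine
  the number of occupied and of free spaces, so only the drivers going home need to be tracked.
\<close>

section \<open>Lists of preferences\<close>

fun arrive :: "nat \<Rightarrow> nat set \<times> nat \<Rightarrow> nat \<Rightarrow> nat set \<times> nat" where
  "arrive n (S, h) p =
     (case parking_space n S p of None \<Rightarrow> (S, Suc h) | Some q \<Rightarrow> (insert q S, h))"

definition outcome :: "nat \<Rightarrow> nat list \<Rightarrow> nat set \<times> nat" where
  "outcome n = foldl (arrive n) ({}, 0)"

abbreviation parked :: "nat \<Rightarrow> nat list \<Rightarrow> nat set" where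
  "parked n xs \<equiv> fst (outcome n xs)"

abbreviation home :: "nat \<Rightarrow> nat list \<Rightarrow> nat" where
  "home n xs \<equiv> snd (outcome n xs)"

lemma outcome_Nil [simp]: "outcome n [] = ({}, 0)"
  by (simp add: outcome_def)

lemma outcome_snoc: "outcome n (xs @ [x]) = arrive n (outcome n xs) x"
  by (simp add: outcome_def)

lemma park_eq_outcome: "park n f m = outcome n (map f [1..<Suc m])"
proof (induction m)
  case 0
  then show ?case by simp
next
  case (Suc m)
  have "[1..<Suc (Suc m)] = [1..<Suc m] @ [Suc m]"
    by simp
  then have "outcome n (map f [1..<Suc (Suc m)]) = arrive n (park n f m) (f (Suc m))"
    by (simp only: map_append list.map outcome_snoc Suc.IH)
  then show ?case
    by (cases "park n f m") (simp del: upt_Suc)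
qed

lemma parking_space_SomeD:
  assumes "parking_space n S p = Some q"
  shows "q \<in> {p..n} - S"
proof -
  have "{p..n} - S \<noteq> {}" and "q = Min ({p..n} - S)"
    using assms by (auto simp: parking_space_def split: if_splits)
  then show ?thesis
    using Min_in[of "{p..n} - S"] by simp
qed

lemma parked_subset:
  assumes "set xs \<subseteq> {1..}"
  shows "parked n xs \<subseteq> {1..n}"
  using assms
proof (induction xs rule: rev_induct)
  case (snoc x xs)
  then show ?case
    by (cases "outcome n xs")
      (auto simp: outcome_snoc dest!: parking_space_SomeD split: option.split)
qed simp

lemma card_parked_plus_home: "finite (parked n xs) \<and> card (parked n xs) + home n xs = length xs"
proof (induction xs rule: rev_induct)
  case (snoc x xs)
  then show ?case
    by (cases "outcome n xs")
      (auto simp: outcome_snoc dest!: parking_space_SomeD split: option.split)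
qed simp

definition assignments :: "nat \<Rightarrow> nat \<Rightarrow> nat \<Rightarrow> nat list set" where
  "assignments n m h = {xs. set xs \<subseteq> {1..n} \<and> length xs = m \<and> home n xs = h}"

lemma finite_assignments: "finite (assignments n m h)"
  by (rule finite_subset[OF _ finite_lists_length_eq[of "{1..n}" m]])
    (auto simp: assignments_def)

lemma bij_betw_PiE_lists:
  "bij_betw (\<lambda>f. map f [1..<Suc m]) ({1..m} \<rightarrow>\<^sub>E A) {xs. set xs \<subseteq> A \<and> length xs = m}"
proof (rule bij_betw_byWitness[where f' = "\<lambda>xs. \<lambda>j\<in>{1..m}. xs ! (j - 1)"])
  show "\<forall>f\<in>{1..m} \<rightarrow>\<^sub>E A. (\<lambda>j\<in>{1..m}. map f [1..<Suc m] ! (j - 1)) = f"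
    by (auto simp: fun_eq_iff restrict_def PiE_def extensional_def simp del: upt_Suc)
  show "\<forall>xs\<in>{xs. set xs \<subseteq> A \<and> length xs = m}.
      map (\<lambda>j\<in>{1..m}. xs ! (j - 1)) [1..<Suc m] = xs"
    by (auto intro!: nth_equalityI simp del: upt_Suc)
  show "(\<lambda>f. map f [1..<Suc m]) ` ({1..m} \<rightarrow>\<^sub>E A) \<subseteq> {xs. set xs \<subseteq> A \<and> length xs = m}"
    by (auto simp: PiE_iff simp del: upt_Suc)
  show "(\<lambda>xs. \<lambda>j\<in>{1..m}. xs ! (j - 1)) ` {xs. set xs \<subseteq> A \<and> length xs = m} \<subseteq> {1..m} \<rightarrow>\<^sub>E A"
    by (auto intro!: subsetD[OF _ nth_mem])
qed

text \<open>
  The prescribed numbers of free and of occupied spaces follow from the one of drivers going home,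
  because every driver either occupies a space of his own or goes home.
\<close>

lemma parking_count_eq_card_assignments:
  "parking_count (int r) (int s) (int k) = card (assignments (r + s) (s + k) k)"
proof -
  let ?n = "r + s" and ?m = "s + k"
  let ?F = "{f \<in> {1..?m} \<rightarrow>\<^sub>E {1..?n}. case park ?n f ?m of (S, h) \<Rightarrow>
      card ({1..?n} - S) = r \<and> card S = s \<and> h = k}"
  let ?to_list = "\<lambda>f. map f [1..<Suc ?m]"
  have iff: "card ({1..?n} - parked ?n xs) = r \<and> card (parked ?n xs) = s \<and> home ?n xs = k \<longleftrightarrow>
      home ?n xs = k" if "set xs \<subseteq> {1..?n}" "length xs = ?m" for xs
  proof -
    have "parked ?n xs \<subseteq> {1..?n}"
      using that by (intro parked_subset) auto
    then show ?thesis
      using card_parked_plus_home[of ?n xs] that by (auto simp: card_Diff_subset)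
  qed
  have "bij_betw ?to_list ?F (assignments ?n ?m k)"
  proof (rule bij_betw_subset[OF bij_betw_PiE_lists[of ?m "{1..?n}"]])
    have lists: "?to_list ` ({1..?m} \<rightarrow>\<^sub>E {1..?n}) = {xs. set xs \<subseteq> {1..?n} \<and> length xs = ?m}"
      by (rule bij_betw_imp_surj_on[OF bij_betw_PiE_lists])
    have F: "?F = {f \<in> {1..?m} \<rightarrow>\<^sub>E {1..?n}. home ?n (?to_list f) = k}"
    proof (intro Collect_cong conj_cong refl)
      fix f assume f: "f \<in> {1..?m} \<rightarrow>\<^sub>E {1..?n}"
      then have "?to_list f \<in> {xs. set xs \<subseteq> {1..?n} \<and> length xs = ?m}"
        unfolding lists[symmetric] by (rule imageI)
      then show "(case park ?n f ?m of (S, h) \<Rightarrow>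
          card ({1..?n} - S) = r \<and> card S = s \<and> h = k) \<longleftrightarrow> home ?n (?to_list f) = k"
        using iff[of "?to_list f"] by (simp add: park_eq_outcome case_prod_beta del: upt_Suc)
    qed
    have "?to_list ` {f \<in> {1..?m} \<rightarrow>\<^sub>E {1..?n}. home ?n (?to_list f) = k} =
        {xs \<in> ?to_list ` ({1..?m} \<rightarrow>\<^sub>E {1..?n}). home ?n xs = k}"
      by blast
    then show "?to_list ` ?F = assignments ?n ?m k"
      by (simp only: F lists assignments_def mem_Collect_eq conj_assoc)
  qed blast
  then have "card ?F = card (assignments ?n ?m k)"
    by (rule bij_betw_same_card)
  moreover have "nat (int s + int k) = s + k" "nat (int r + int s) = r + s"
    by auto
  ultimately show ?thesis
    by (simp add: parking_count_def Let_def)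
qed

section \<open>The last space\<close>

lemma parking_space_Suc:
  assumes "p \<le> Suc n" and "S' \<inter> {..n} = S"
  shows "parking_space (Suc n) S' p =
    (case parking_space n S p of
       None \<Rightarrow> if Suc n \<in> S' then None else Some (Suc n)
     | Some q \<Rightarrow> Some q)"
proof -
  let ?free = "{p..n} - S"
  have free': "{p..Suc n} - S' = ?free \<union> ({Suc n} - S')"
    using assms by (auto simp: le_Suc_eq)
  show ?thesis
  proof (cases "?free = {}")
    case True
    show ?thesis
      by (simp add: parking_space_def free' True insert_Diff_if del: Diff_eq_empty_iff)
  next
    case False
    \<comment> \<open>The additional free space is larger than all others and leaves the minimum unchanged.\<close>
    have "Min ?free \<in> ?free"
      using False by (intro Min_in) auto
    then have "Min (?free \<union> ({Suc n} - S')) = Min ?free"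
      by (intro Min_eqI) (auto intro: Min_le)
    then show ?thesis
      using False unfolding parking_space_def free' by auto
  qed
qed

text \<open>
  The drivers who leave the first \<open>n\<close> spaces without parking all pass by space \<open>n + 1\<close>, where the
  first of them parks. Truncated subtraction covers the case that there is none.
\<close>

lemma outcome_Suc:
  assumes "set xs \<subseteq> {1..Suc n}"
  shows "outcome (Suc n) xs =
    (if home n xs = 0 then parked n xs else insert (Suc n) (parked n xs), home n xs - 1)"
  using assms
proof (induction xs rule: rev_induct)
  case (snoc x xs)
  obtain S h where Sh: "outcome n xs = (S, h)"
    by fastforce
  have S: "S \<subseteq> {1..n}"
    using parked_subset[of xs n] order.trans[OF snoc.prems, of "{1..}"] Sh by simp
  let ?S' = "if h = 0 then S else insert (Suc n) S"
  have "parking_space (Suc n) ?S' x =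
      (case parking_space n S x of
         None \<Rightarrow> if Suc n \<in> ?S' then None else Some (Suc n)
       | Some q \<Rightarrow> Some q)"
    using snoc.prems S by (intro parking_space_Suc) auto
  moreover have "Suc n \<notin> S"
    using S by auto
  moreover have "outcome (Suc n) xs = (?S', h - 1)"
    using snoc by (simp add: Sh)
  ultimately show ?case
    by (cases "h = 0") (auto simp: outcome_snoc Sh split: option.split)
qed simp

lemma outcome_ignore_last:
  "outcome n xs =
    (parked n (filter (\<lambda>x. x \<noteq> Suc n) xs),
     home n (filter (\<lambda>x. x \<noteq> Suc n) xs) + count_list xs (Suc n))"
proof (induction xs rule: rev_induct)
  case (snoc x xs)
  have "parking_space n S (Suc n) = None" for S
    by (simp add: parking_space_def)
  then show ?case
    using snoc
    by (cases "outcome n (filter (\<lambda>x. x \<noteq> Suc n) xs)")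
      (auto simp: outcome_snoc split: option.split)
qed simp

section \<open>Counting assignments by their last space\<close>

lemma filter_eq_conv_replicate: "filter (\<lambda>x. x = a) xs = replicate (count_list xs a) a"
  by (induction xs) auto

text \<open>
  A list is a shuffle of its entries equal to \<open>a\<close> with its remaining entries, and shuffles of lists
  without common entries are counted by binomial coefficients.
\<close>

lemma card_lists_filter_neq:
  assumes "a \<notin> set ys"
  shows "finite {xs. filter (\<lambda>x. x \<noteq> a) xs = ys \<and> count_list xs a = c}" (is "finite ?X")
    and "card {xs. filter (\<lambda>x. x \<noteq> a) xs = ys \<and> count_list xs a = c} =
      (length ys + c) choose c"
proof -
  have "?X = partition (\<lambda>x. x = a) -` {(replicate c a, ys)}"
    by (auto simp: filter_eq_conv_replicate o_def dest: arg_cong[where f = length])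
  also have "\<dots> = shuffles (replicate c a) ys"
    using assms by (intro inv_image_partition) auto
  finally have X: "?X = shuffles (replicate c a) ys" .
  then show "finite ?X"
    by simp
  have "card (shuffles (replicate c a) ys) = (c + length ys) choose c"
    using assms by (subst card_disjoint_shuffles) auto
  then show "card ?X = (length ys + c) choose c"
    by (simp add: X add.commute)
qed

lemma card_lists_filter_neq_in:
  assumes "finite Y" and "\<And>ys. ys \<in> Y \<Longrightarrow> a \<notin> set ys \<and> length ys = d"
  shows "card {xs. filter (\<lambda>x. x \<noteq> a) xs \<in> Y \<and> count_list xs a = c} =
    ((d + c) choose c) * card Y"
proof -
  let ?X = "\<lambda>ys. {xs. filter (\<lambda>x. x \<noteq> a) xs = ys \<and> count_list xs a = c}"
  have "{xs. filter (\<lambda>x. x \<noteq> a) xs \<in> Y \<and> count_list xs a = c} = (\<Union>ys\<in>Y. ?X ys)"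
    by auto
  also have "card \<dots> = (\<Sum>ys\<in>Y. card (?X ys))"
    using assms by (intro card_UN_disjoint) (auto simp: card_lists_filter_neq(1))
  also have "\<dots> = (\<Sum>ys\<in>Y. (d + c) choose c)"
    using assms by (intro sum.cong) (auto simp: card_lists_filter_neq(2))
  finally show ?thesis
    by simp
qed

lemma length_filter_neq_plus_count_list:
  "length (filter (\<lambda>x. x \<noteq> a) xs) + count_list xs a = length xs"
  by (induction xs) auto

text \<open>
  Here the drivers who want the last space are separated from the others, whose choices form an
  assignment to the first \<open>n\<close> spaces. If there are more than \<open>m\<close> of the former, both sides vanish.
\<close>

lemma card_assignments_split_last:
  "card {xs. set xs \<subseteq> {1..Suc n} \<and> length xs = m \<and> count_list xs (Suc n) = c \<and>
      home n (filter (\<lambda>x. x \<noteq> Suc n) xs) = i} =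
    (m choose c) * card (assignments n (m - c) i)" (is "card ?T = _")
proof (cases "c \<le> m")
  case True
  have "set xs \<subseteq> {1..Suc n} \<longleftrightarrow> set (filter (\<lambda>x. x \<noteq> Suc n) xs) \<subseteq> {1..n}" for xs
    by (auto simp: le_Suc_eq subset_iff)
  moreover have "length xs = m \<longleftrightarrow> length (filter (\<lambda>x. x \<noteq> Suc n) xs) = m - c"
    if "count_list xs (Suc n) = c" for xs
    using length_filter_neq_plus_count_list[of "Suc n" xs] that True by linarith
  ultimately have "?T =
      {xs. filter (\<lambda>x. x \<noteq> Suc n) xs \<in> assignments n (m - c) i \<and> count_list xs (Suc n) = c}"
    unfolding assignments_def by blast
  moreover have "Suc n \<notin> set ys \<and> length ys = m - c" if "ys \<in> assignments n (m - c) i" for ys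
    using that by (auto simp: assignments_def)
  ultimately have "card ?T = ((m - c + c) choose c) * card (assignments n (m - c) i)"
    by (simp only:) (intro card_lists_filter_neq_in finite_assignments; blast)
  then show ?thesis
    using True by simp
next
  case False
  then have "count_list xs (Suc n) \<noteq> c" if "length xs = m" for xs
    using count_le_length[of xs "Suc n"] that by auto
  then have empty: "?T = {}"
    by blast
  show ?thesis
    unfolding empty using False by simp
qed

text \<open>
  The recursion for a fixed number of drivers. The first summand counts the assignments that leave
  the last space free; the index \<open>i\<close> of the sum is the number of drivers who reach the last space
  from a smaller preference.
\<close>

lemma card_assignments_Suc:
  "card (assignments (Suc n) m k) =
    (if k = 0 then card (assignments n m 0) else 0) +
    (\<Sum>i = 0..k + 1. (m choose (k + 1 - i)) * card (assignments n (m - (k + 1 - i)) i))"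
proof -
  let ?U = "{xs. set xs \<subseteq> {1..Suc n} \<and> length xs = m}"
  let ?free = "{xs \<in> ?U. k = 0 \<and> home n xs = 0}"
  let ?taken = "{xs \<in> ?U. home n xs = k + 1}"
  let ?T = "\<lambda>i. {xs. set xs \<subseteq> {1..Suc n} \<and> length xs = m \<and>
    count_list xs (Suc n) = k + 1 - i \<and> home n (filter (\<lambda>x. x \<noteq> Suc n) xs) = i}"
  have home_eq: "home n xs = home n (filter (\<lambda>x. x \<noteq> Suc n) xs) + count_list xs (Suc n)" for xs
    by (subst outcome_ignore_last) simp
  have fin: "finite ?U"
    by (rule finite_lists_length_eq) simp
  have "assignments (Suc n) m k = ?free \<union> ?taken"
    unfolding assignments_def by (auto simp: outcome_Suc)
  moreover have "finite ?free" "finite ?taken"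
    by (rule finite_subset[OF _ fin], blast)+
  ultimately have "card (assignments (Suc n) m k) = card ?free + card ?taken"
    by (simp only:) (rule card_Un_disjoint; auto)
  moreover have "?free = (if k = 0 then assignments n m 0 else {})"
  proof -
    have "xs \<in> ?U \<and> home n xs = 0 \<longleftrightarrow> xs \<in> assignments n m 0" for xs
    proof
      assume xs: "xs \<in> ?U \<and> home n xs = 0"
      then have "Suc n \<notin> set xs"
        using home_eq[of xs] by (simp add: count_list_0_iff)
      then show "xs \<in> assignments n m 0"
        using xs by (auto simp: assignments_def subset_iff le_Suc_eq)
    qed (auto simp: assignments_def subset_iff)
    then show ?thesis
      by auto
  qed
  moreover have "card ?taken =
    (\<Sum>i = 0..k + 1. (m choose (k + 1 - i)) * card (assignments n (m - (k + 1 - i)) i))"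
  proof -
    have taken: "?taken = (\<Union>i\<in>{0..k + 1}. ?T i)"
    proof (rule set_eqI)
      show "xs \<in> ?taken \<longleftrightarrow> xs \<in> (\<Union>i\<in>{0..k + 1}. ?T i)" for xs
        using home_eq[of xs] by auto
    qed
    have "card (\<Union>i\<in>{0..k + 1}. ?T i) = (\<Sum>i = 0..k + 1. card (?T i))"
    proof (rule card_UN_disjoint)
      show "\<forall>i\<in>{0..k + 1}. finite (?T i)"
        by (intro ballI finite_subset[OF _ fin]) blast
    qed auto
    then show ?thesis
      by (simp only: taken card_assignments_split_last)
  qed
  ultimately show ?thesis
    by simp
qed

lemma assignments_too_many_drivers:
  assumes "n + h < m"
  shows "assignments n m h = {}"
proof -
  have "home n xs \<noteq> h" if "set xs \<subseteq> {1..n}" "length xs = m" for xs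
  proof -
    have "parked n xs \<subseteq> {1..n}"
      using that by (intro parked_subset) auto
    then have "card (parked n xs) \<le> n"
      using card_mono[of "{1..n}"] by fastforce
    then show ?thesis
      using card_parked_plus_home[of n xs] assms that by linarith
  qed
  then show ?thesis
    by (auto simp: assignments_def)
qed

lemma assignments_too_many_home:
  assumes "m < h"
  shows "assignments n m h = {}"
proof -
  have "home n xs \<noteq> h" if "length xs = m" for xs
    using card_parked_plus_home[of n xs] assms that by linarith
  then show ?thesis
    by (auto simp: assignments_def)
qed

theorem lemma2:
  fixes r s k :: nat
  shows "parking_count (int r) (int s) (int k) =
    (if r = 0 \<and> s = 0 \<and> k = 0 then 1
     else if k = 0 \<and> (r > 0 \<or> s > 0) then
       parking_count (int r - 1) (int s) 0 +
       (\<Sum>i = 0..k + 1. ((s + k) choose (k + 1 - i)) * parking_count (int r) (int s - 1) (int i))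
     else
       (\<Sum>i = 0..k + 1. ((s + k) choose (k + 1 - i)) * parking_count (int r) (int s - 1) (int i)))"
proof (cases "r + s")
  case 0
  then have "assignments (r + s) (s + k) k = (if k = 0 then {[]} else {})"
    by (auto simp: assignments_def)
  moreover have "parking_count (int r) (int s - 1) (int i) = 0" for i
    using 0 by (simp add: parking_count_def)
  ultimately show ?thesis
    using 0 parking_count_eq_card_assignments[of 0 0 k] by simp
next
  case (Suc n)
  have free: "card (assignments n s 0) = parking_count (int r - 1) (int s) 0"
  proof (cases r)
    case 0
    then show ?thesis
      using Suc by (simp add: assignments_too_many_drivers parking_count_def)
  next
    case (Suc r')
    then show ?thesis
      using \<open>r + s = Suc n\<close> parking_count_eq_card_assignments[of r' s 0] by simp
  qed
  have taken: "((s + k) choose (k + 1 - i)) * card (assignments n (s + k - (k + 1 - i)) i) =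
      ((s + k) choose (k + 1 - i)) * parking_count (int r) (int s - 1) (int i)"
    if "i \<in> {0..k + 1}" for i
  proof (cases s)
    case 0
    \<comment> \<open>Without parked drivers, all \<open>k\<close> drivers had to go home after \<open>k + 1\<close> reached the last space.
      For \<open>i = 0\<close> this is excluded by the binomial coefficient, for \<open>i > 0\<close> by \<open>i\<close> drivers
      going home out of \<open>i - 1\<close>.\<close>
    then have "parking_count (int r) (int s - 1) (int i) = 0"
      by (simp add: parking_count_def)
    moreover have "(k choose (k + 1 - i)) * card (assignments n (k - (k + 1 - i)) i) = 0"
      using that by (cases "i = 0") (auto simp: assignments_too_many_home)
    ultimately show ?thesis
      using 0 by simp
  next
    case (Suc s')
    then have "n = r + s'" "s + k - (k + 1 - i) = s' + i"
      using \<open>r + s = Suc n\<close> that by auto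
    then show ?thesis
      using Suc parking_count_eq_card_assignments[of r s' i] by simp
  qed
  have "parking_count (int r) (int s) (int k) =
      (if k = 0 then parking_count (int r - 1) (int s) 0 else 0) +
      (\<Sum>i = 0..k + 1. ((s + k) choose (k + 1 - i)) * parking_count (int r) (int s - 1) (int i))"
    by (simp only: parking_count_eq_card_assignments[of r s k] Suc card_assignments_Suc
        sum.cong[OF refl taken]) (simp add: free)
  then show ?thesis
    using Suc by auto
qed

end
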